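(* Let $K$ be an algebraically closed non-archimedean field with valuation $v$, valuation ring $R$ and residue field $k$ with $\mathrm{char}(k)\neq2,3$. Let $E/K$ be an elliptic curve with $j$-invariant $j$ and minimal Weierstrass model $W/R$. Then: 1. $E$ has good reduction if and only if $v(j)\geq0$; 2. $E$ has multiplicative reduction if and only if $v(j)<0$. In particular, $E$ cannot have additive reduction.
   Context: $v:K^*\to\mathbb{R}$ is extended by $v(0)=\infty$; $R=\{z\in K: v(z)\ge0\}$, $\mathfrak{m}$ is its maximal ideal and $k=R/\mathfrak{m}$. The valuation is not assumed discrete and $K$ is not assumed complete. An integral Weierstrass equation for $E$ is a Weierstrass equation $y^2+a_1xy+a_3y=x^3+a_2x^2+a_4x+a_6$ of $E$ with all $a_i\in R$. It is minimal (a minimal Weierstrass model $W/R$) if the valuation $v(\Delta)$ of its discriminant is minimal among all integral Weierstrass equations for $E$. The reduced curve $\overline{E}/k$ is given by reducing the coefficients $a_i$ of a minimal model modulo $\mathfrak{m}$; up to isomorphism it does not depend on the minimal model. $E$ has good reduction if $\overline{E}$ is an elliptic curve (nonsingular; equivalently $v(\Delta)=0$), additive reduction if $\overline{E}$ has a cusp, and multiplicative reduction if $\overline{E}$ has a node. *)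

theory Defs
  imports
    "HOL-Computational_Algebra.Polynomial"
    "HOL-Library.Extended_Real"
begin

section \<open>Non-archimedean valued fields\<close>

text \<open>
  The valuation is finite and real-valued on nonzero elements and extended by \<open>val 0 = \<infinity>\<close>. Its value
  group is an arbitrary subgroup of the reals, and the field need not be complete.
\<close>
class valued_field = field +
  fixes val :: "'a \<Rightarrow> ereal"
  assumes val_eq_infinity_iff: "val x = \<infinity> \<longleftrightarrow> x = 0"
    and val_neq_minus_infinity: "val x \<noteq> - \<infinity>"
    and val_mult: "val (x * y) = val x + val y"
    and val_add: "min (val x) (val y) \<le> val (x + y)"

definition val_ring :: "'a::valued_field set" where
  "val_ring = {z. 0 \<le> val z}"

definition val_ideal :: "'a::valued_field set" where
  "val_ideal = {z. 0 < val z}"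

lemma val_0 [simp]: "val (0 :: 'a::valued_field) = \<infinity>"
  by (simp add: val_eq_infinity_iff)

lemma val_1 [simp]: "val (1 :: 'a::valued_field) = 0"
proof -
  have "val (1 :: 'a) = val (1 :: 'a) + val (1 :: 'a)"
    using val_mult[of 1 "1 :: 'a"] by simp
  moreover have "val (1 :: 'a) \<noteq> \<infinity>" "val (1 :: 'a) \<noteq> - \<infinity>"
    by (simp_all add: val_eq_infinity_iff val_neq_minus_infinity)
  ultimately show ?thesis
    by (cases "val (1 :: 'a)") auto
qed

lemma val_minus [simp]: "val (- x :: 'a::valued_field) = val x"
proof -
  have "0 = val (- 1 :: 'a) + val (- 1 :: 'a)"
    using val_mult[of "- 1" "- 1 :: 'a"] by simp
  hence "val (- 1 :: 'a) = 0"
    by (cases "val (- 1 :: 'a)") auto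
  thus ?thesis
    using val_mult[of "- 1" x] by simp
qed

lemma val_inverse:
  fixes x :: "'a::valued_field"
  assumes "x \<noteq> 0"
  shows "val (inverse x) = - val x"
proof -
  have "val x + val (inverse x) = 0"
    using val_mult[of x "inverse x"] assms by simp
  thus ?thesis
    by (cases "val x"; cases "val (inverse x)") auto
qed

lemma val_ring_0 [simp]: "0 \<in> val_ring"
  and val_ring_1 [simp]: "1 \<in> val_ring"
  and val_ring_minus: "x \<in> val_ring \<Longrightarrow> - x \<in> val_ring"
  and val_ring_add: "x \<in> val_ring \<Longrightarrow> y \<in> val_ring \<Longrightarrow> x + y \<in> val_ring"
  and val_ring_mult: "x \<in> val_ring \<Longrightarrow> y \<in> val_ring \<Longrightarrow> x * y \<in> val_ring"
  using order_trans[OF _ val_add[of x y], of 0] by (auto simp: val_ring_def val_mult)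

lemma val_ring_diff: "x \<in> val_ring \<Longrightarrow> y \<in> val_ring \<Longrightarrow> x - y \<in> val_ring"
  using val_ring_add[of x "- y"] val_ring_minus[of y] by simp

lemma val_ideal_0 [simp]: "0 \<in> val_ideal"
  and val_ideal_1 [simp]: "1 \<notin> val_ideal"
  and val_ideal_minus: "x \<in> val_ideal \<Longrightarrow> - x \<in> val_ideal"
  and val_ideal_add: "x \<in> val_ideal \<Longrightarrow> y \<in> val_ideal \<Longrightarrow> x + y \<in> val_ideal"
  using less_le_trans[OF _ val_add[of x y], of 0] by (auto simp: val_ideal_def)

lemma val_ideal_diff: "x \<in> val_ideal \<Longrightarrow> y \<in> val_ideal \<Longrightarrow> x - y \<in> val_ideal"
  using val_ideal_add[of x "- y"] val_ideal_minus[of y] by simp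

lemma val_ideal_mult: "x \<in> val_ring \<Longrightarrow> y \<in> val_ideal \<Longrightarrow> x * y \<in> val_ideal"
  by (auto simp: val_ring_def val_ideal_def val_mult add_nonneg_pos)

lemma val_ideal_mult': "x \<in> val_ideal \<Longrightarrow> y \<in> val_ring \<Longrightarrow> x * y \<in> val_ideal"
  using val_ideal_mult[of y x] by (simp add: mult.commute)

lemma val_ideal_imp_val_ring: "x \<in> val_ideal \<Longrightarrow> x \<in> val_ring"
  by (auto simp: val_ring_def val_ideal_def)

lemma val_ideal_iff_nonunit:
  "x \<in> val_ideal \<longleftrightarrow> x \<in> val_ring \<and> \<not> (\<exists>y\<in>val_ring. x * y = 1)"
proof (cases "x \<in> val_ring \<and> x \<noteq> 0")
  case True
  hence "(\<exists>y\<in>val_ring. x * y = 1) \<longleftrightarrow> inverse x \<in> val_ring"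
    by (metis inverse_unique right_inverse)
  also have "\<dots> \<longleftrightarrow> val x \<le> 0"
    using True by (simp add: val_ring_def val_inverse)
  finally show ?thesis
    using True by (auto simp: val_ideal_def)
qed (use val_ideal_imp_val_ring in auto)


section \<open>The residue field\<close>

definition residue_rel :: "'a::valued_field \<Rightarrow> 'a \<Rightarrow> bool" where
  "residue_rel x y \<longleftrightarrow> x \<in> val_ring \<and> y \<in> val_ring \<and> x - y \<in> val_ideal"

lemma residue_rel_refl_iff [simp]: "residue_rel x x \<longleftrightarrow> x \<in> val_ring"
  by (simp add: residue_rel_def)

lemma part_equivp_residue_rel: "part_equivp residue_rel"
proof (rule part_equivpI)
  show "\<exists>x :: 'a. residue_rel x x"
    by (rule exI[of _ 0]) simp
  show "symp (residue_rel :: 'a \<Rightarrow> _)"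
    using val_ideal_minus by (fastforce simp: residue_rel_def intro!: sympI)
  show "transp (residue_rel :: 'a \<Rightarrow> _)"
  proof (rule transpI)
    fix x y z :: 'a
    assume "residue_rel x y" "residue_rel y z"
    thus "residue_rel x z"
      using val_ideal_add[of "x - y" "y - z"] by (simp add: residue_rel_def)
  qed
qed

text \<open>
  The partial quotient below is the quotient of the valuation ring by its maximal ideal:
  elements outside the valuation ring are not in the domain of \<open>residue_rel\<close>. The
  projection \<open>to_residue\<close> is meaningful on \<open>val_ring\<close> only.
\<close>
quotient_type (overloaded) 'a residue = "'a::valued_field" / partial: residue_rel
  morphisms rep_residue to_residue
  by (rule part_equivp_residue_rel)

lemma Domainp_pcr_residue [transfer_domain_rule]:
  "Domainp (pcr_residue (=) :: 'a::valued_field \<Rightarrow> _) = (\<lambda>x. x \<in> val_ring)"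
  by (simp add: residue.domain_eq fun_eq_iff)

instantiation residue :: (valued_field) field
begin

lift_definition zero_residue :: "'a residue" is 0 by simp

lift_definition one_residue :: "'a residue" is 1 by simp

lift_definition plus_residue :: "'a residue \<Rightarrow> 'a residue \<Rightarrow> 'a residue" is "(+)"
  using val_ideal_add by (fastforce simp: residue_rel_def val_ring_add add_diff_add)

lift_definition uminus_residue :: "'a residue \<Rightarrow> 'a residue" is uminus
  using val_ideal_minus by (fastforce simp: residue_rel_def val_ring_minus)

lift_definition minus_residue :: "'a residue \<Rightarrow> 'a residue \<Rightarrow> 'a residue" is "(-)"
proof -
  fix x x' y y' :: 'a
  assume "residue_rel x x'" "residue_rel y y'"
  thus "residue_rel (x - y) (x' - y')"
    using val_ideal_diff[of "x - x'" "y - y'"]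
    by (simp add: residue_rel_def val_ring_diff algebra_simps)
qed

lift_definition times_residue :: "'a residue \<Rightarrow> 'a residue \<Rightarrow> 'a residue" is "(*)"
proof -
  fix x x' y y' :: 'a
  assume *: "residue_rel x x'" "residue_rel y y'"
  hence "x * (y - y') + (x - x') * y' \<in> val_ideal"
    unfolding residue_rel_def by (blast intro: val_ideal_add val_ideal_mult val_ideal_mult')
  thus "residue_rel (x * y) (x' * y')"
    using * by (simp add: residue_rel_def val_ring_mult mult_diff_mult)
qed

lift_definition inverse_residue :: "'a residue \<Rightarrow> 'a residue"
  is "\<lambda>x. if x \<in> val_ideal then 0 else inverse x"
proof -
  fix x y :: 'a
  assume *: "residue_rel x y"
  show "residue_rel (if x \<in> val_ideal then 0 else inverse x)
          (if y \<in> val_ideal then 0 else inverse y)"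
  proof (cases "x \<in> val_ideal")
    case True
    hence "y \<in> val_ideal"
      using * val_ideal_diff[of x "x - y"] by (simp add: residue_rel_def)
    with True show ?thesis by simp
  next
    case False
    hence "y \<notin> val_ideal"
      using * val_ideal_add[of "x - y" y] by (auto simp: residue_rel_def)
    hence 0: "val x = 0" "val y = 0"
      using * False by (auto simp: residue_rel_def val_ring_def val_ideal_def)
    hence nz: "x \<noteq> 0" "y \<noteq> 0" by auto
    have inv: "inverse x \<in> val_ring" "inverse y \<in> val_ring"
      using 0 nz by (simp_all add: val_ring_def val_inverse)
    have "inverse x - inverse y = - (inverse x * (x - y) * inverse y)"
      using nz by (simp add: field_simps)
    also have "\<dots> \<in> val_ideal"
      using * inv unfolding residue_rel_def
      by (blast intro: val_ideal_minus val_ideal_mult val_ideal_mult')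
    finally show ?thesis
      using False \<open>y \<notin> val_ideal\<close> inv by (simp add: residue_rel_def)
  qed
qed

definition divide_residue :: "'a residue \<Rightarrow> 'a residue \<Rightarrow> 'a residue" where
  "divide_residue x y = x * inverse y"

instance
proof
  fix a b c :: "'a residue"
  show "a + b + c = a + (b + c)"
    by transfer (simp add: add.assoc val_ring_add)
  show "a + b = b + a"
    by transfer (simp add: add.commute val_ring_add)
  show "0 + a = a"
    by transfer simp
  show "- a + a = 0"
    by transfer simp
  show "a - b = a + - b"
    by transfer (simp add: val_ring_diff)
  show "a * b * c = a * (b * c)"
    by transfer (simp add: mult.assoc val_ring_mult)
  show "a * b = b * a"
    by transfer (simp add: mult.commute val_ring_mult)
  show "1 * a = a"
    by transfer simp
  show "(a + b) * c = a * c + b * c"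
    by transfer (simp add: distrib_right val_ring_mult val_ring_add)
  show "(0 :: 'a residue) \<noteq> 1"
    by transfer (use val_ideal_minus in \<open>fastforce simp: residue_rel_def\<close>)
  show "inverse a * a = 1" if "a \<noteq> 0"
    using that
  proof transfer
    fix a :: 'a
    assume a: "a \<in> val_ring" "\<not> residue_rel a 0"
    hence "a \<notin> val_ideal" "a \<noteq> 0"
      by (auto simp: residue_rel_def)
    thus "residue_rel ((if a \<in> val_ideal then 0 else inverse a) * a) 1"
      by simp
  qed
  show "a div b = a * inverse b"
    by (fact divide_residue_def)
  show "inverse (0 :: 'a residue) = 0"
    by transfer simp
qed

end

lemma to_residue_eq_iff:
  "x \<in> val_ring \<Longrightarrow> y \<in> val_ring \<Longrightarrow> to_residue x = to_residue y \<longleftrightarrow> x - y \<in> val_ideal"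
  using residue.rel_eq_transfer
  unfolding residue.pcr_cr_eq cr_residue_def rel_fun_def residue_rel_def by auto

lemma to_residue_surj: "\<exists>x\<in>val_ring. to_residue x = a"
  using Quotient_rep_abs[OF Quotient_residue] Quotient_abs_rep[OF Quotient_residue]
    Quotient_rep_reflp[OF Quotient_residue]
  by (metis residue_rel_refl_iff)

lemma to_residue_0 [simp]: "to_residue 0 = 0"
  by (simp add: zero_residue_def)

lemma to_residue_1 [simp]: "to_residue 1 = 1"
  by (simp add: one_residue_def)

lemma to_residue_add:
  "x \<in> val_ring \<Longrightarrow> y \<in> val_ring \<Longrightarrow> to_residue (x + y) = to_residue x + to_residue y"
  by (simp add: plus_residue.abs_eq eq_onp_def)

lemma to_residue_mult:
  "x \<in> val_ring \<Longrightarrow> y \<in> val_ring \<Longrightarrow> to_residue (x * y) = to_residue x * to_residue y"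
  by (simp add: times_residue.abs_eq eq_onp_def)

text \<open>
  Over an algebraically closed field the residue field is algebraically closed as well, so
  that its rational points are already its geometric points.
\<close>
instance residue :: ("{alg_closed_field, valued_field}") alg_closed_field
proof (rule alg_closedI)
  fix p :: "'a residue poly"
  assume p: "degree p > 0" "lead_coeff p = 1"
  define n where "n = degree p"
  define f :: "nat \<Rightarrow> 'a"
    where "f i = (if i = n then 1 else SOME x. x \<in> val_ring \<and> to_residue x = coeff p i)" for i
  have f: "f i \<in> val_ring \<and> to_residue (f i) = coeff p i" for i
  proof (cases "i = n")
    case False
    have "\<exists>x. x \<in> val_ring \<and> to_residue x = coeff p i"
      using to_residue_surj[of "coeff p i"] by blast
    from someI_ex[OF this] False show ?thesis by (simp add: f_def)
  qed (use p in \<open>simp add: f_def n_def\<close>)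
  have "\<exists>z. (\<Sum>k\<le>n. f k * z ^ k) = 0"
    using p(1) by (intro alg_closed) (auto simp: f_def n_def)
  then obtain z where z: "(\<Sum>k\<le>n. f k * z ^ k) = 0" ..
  have [simp]: "f n = 1"
    by (simp add: f_def)
  have pow: "x ^ k \<in> val_ring" if "x \<in> val_ring" for x :: 'a and k
    by (induction k) (simp_all add: that val_ring_mult)
  have "z \<in> val_ring"
  proof (rule ccontr)
    assume "z \<notin> val_ring"
    hence "z \<noteq> 0" "val z < 0"
      by (auto simp: val_ring_def)
    define w where "w = inverse z"
    have w: "w \<in> val_ideal"
      using \<open>z \<noteq> 0\<close> \<open>val z < 0\<close> by (simp add: w_def val_ideal_def val_inverse)
    have "0 = w ^ n * (\<Sum>k\<le>n. f k * z ^ k)"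
      by (simp add: z)
    also have "\<dots> = (\<Sum>k\<le>n. f k * w ^ (n - k))"
      unfolding sum_distrib_left
    proof (rule sum.cong)
      fix k assume "k \<in> {..n}"
      hence "w ^ n = w ^ (n - k) * w ^ k"
        by (metis atMost_iff le_add_diff_inverse2 power_add)
      moreover have "w ^ k * z ^ k = 1"
        using \<open>z \<noteq> 0\<close> by (simp add: w_def power_inverse)
      ultimately show "w ^ n * (f k * z ^ k) = f k * w ^ (n - k)"
        by (simp add: ac_simps)
    qed simp
    also have "\<dots> = (\<Sum>k<n. f k * w ^ (n - k)) + 1"
      by (simp only: lessThan_Suc_atMost[symmetric] sum.lessThan_Suc) simp
    finally have "(\<Sum>k<n. f k * w ^ (n - k)) = - 1"
      by (simp add: eq_neg_iff_add_eq_0)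
    moreover have "(\<Sum>k<m. f k * w ^ (n - k)) \<in> val_ideal" if "m \<le> n" for m
      using that
    proof (induction m)
      case (Suc m)
      have "w ^ (n - m) = w ^ (n - Suc m) * w"
        using Suc.prems by (metis Suc_diff_Suc Suc_le_lessD power_Suc2)
      hence "f m * w ^ (n - m) \<in> val_ideal"
        using f w pow val_ideal_imp_val_ring by (auto intro!: val_ideal_mult)
      thus ?case
        using Suc by (simp add: val_ideal_add)
    qed simp
    ultimately have "- 1 \<in> (val_ideal :: 'a set)"
      by (metis order_refl)
    thus False
      using val_ideal_minus[of "- 1 :: 'a"] by simp
  qed
  have hom_pow: "to_residue (z ^ k) = to_residue z ^ k" for k
    by (induction k) (simp_all add: to_residue_mult pow \<open>z \<in> val_ring\<close>)
  have "(\<Sum>k<m. f k * z ^ k) \<in> val_ring \<and>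
        to_residue (\<Sum>k<m. f k * z ^ k) = (\<Sum>k<m. coeff p k * to_residue z ^ k)" for m
  proof (induction m)
    case (Suc m)
    have "f m \<in> val_ring" "z ^ m \<in> val_ring" "to_residue (f m) = coeff p m"
      using f \<open>z \<in> val_ring\<close> pow by blast+
    with Suc show ?case
      by (simp add: to_residue_add to_residue_mult val_ring_add val_ring_mult hom_pow)
  qed simp
  hence "to_residue (\<Sum>k\<le>n. f k * z ^ k) = (\<Sum>k\<le>n. coeff p k * to_residue z ^ k)"
    by (metis lessThan_Suc_atMost)
  hence "poly p (to_residue z) = 0"
    by (simp add: z poly_altdef flip: n_def)
  thus "\<exists>x. poly p x = 0" ..
qed


section \<open>Weierstrass equations\<close>

text \<open>The curve \<open>y\<^sup>2 + a\<^sub>1 x y + a\<^sub>3 y = x\<^sup>3 + a\<^sub>2 x\<^sup>2 + a\<^sub>4 x + a\<^sub>6\<close>.\<close>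
datatype 'a weierstrass = Weierstrass (a1: 'a) (a2: 'a) (a3: 'a) (a4: 'a) (a6: 'a)

definition b2 :: "'a::comm_ring_1 weierstrass \<Rightarrow> 'a" where
  "b2 W = a1 W ^ 2 + 4 * a2 W"

definition b4 :: "'a::comm_ring_1 weierstrass \<Rightarrow> 'a" where
  "b4 W = 2 * a4 W + a1 W * a3 W"

definition b6 :: "'a::comm_ring_1 weierstrass \<Rightarrow> 'a" where
  "b6 W = a3 W ^ 2 + 4 * a6 W"

definition b8 :: "'a::comm_ring_1 weierstrass \<Rightarrow> 'a" where
  "b8 W = a1 W ^ 2 * a6 W + 4 * a2 W * a6 W - a1 W * a3 W * a4 W + a2 W * a3 W ^ 2 - a4 W ^ 2"

definition c4 :: "'a::comm_ring_1 weierstrass \<Rightarrow> 'a" where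
  "c4 W = b2 W ^ 2 - 24 * b4 W"

definition discriminant :: "'a::comm_ring_1 weierstrass \<Rightarrow> 'a" where
  "discriminant W = - (b2 W ^ 2 * b8 W) - 8 * b4 W ^ 3 - 27 * b6 W ^ 2 + 9 * b2 W * b4 W * b6 W"

definition j_invariant :: "'a::field weierstrass \<Rightarrow> 'a" where
  "j_invariant W = c4 W ^ 3 / discriminant W"

text \<open>
  Bivariate polynomials are polynomials in \<open>y\<close> whose coefficients are polynomials in \<open>x\<close>; the
  following is \<open>y\<^sup>2 + (a\<^sub>1 x + a\<^sub>3) y - (x\<^sup>3 + a\<^sub>2 x\<^sup>2 + a\<^sub>4 x + a\<^sub>6)\<close>.
\<close>
definition weierstrass_poly :: "'a::comm_ring_1 weierstrass \<Rightarrow> 'a poly poly" where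
  "weierstrass_poly W = [: - [: a6 W, a4 W, a2 W, 1 :], [: a3 W, a1 W :], 1 :]"

definition poly2 :: "'a::comm_ring_1 poly poly \<Rightarrow> 'a \<Rightarrow> 'a \<Rightarrow> 'a" where
  "poly2 F x y = poly (poly F [: y :]) x"


subsection \<open>Singular points\<close>

text \<open>
  In this subsection the base field is algebraically closed, so it suffices to consider rational
  points. The point at infinity \<open>[0 : 1 : 0]\<close> of the projective closure is smooth for every
  Weierstrass equation (the \<open>Z\<close>-derivative of the homogenised equation is 1 there), so
  singular points are always affine.
\<close>
definition singular_point :: "'a::alg_closed_field weierstrass \<Rightarrow> 'a \<Rightarrow> 'a \<Rightarrow> bool" where
  "singular_point W x y \<longleftrightarrow>
     poly2 (weierstrass_poly W) x y = 0 \<and>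
     poly2 (map_poly pderiv (weierstrass_poly W)) x y = 0 \<and>
     poly2 (pderiv (weierstrass_poly W)) x y = 0"

definition elliptic_curve :: "'a::alg_closed_field weierstrass \<Rightarrow> bool" where
  "elliptic_curve W \<longleftrightarrow> (\<nexists>x y. singular_point W x y)"

text \<open>
  The Taylor expansion of the equation at \<open>(x\<^sub>0, y\<^sub>0)\<close> is
  \<open>((y - y\<^sub>0) - \<alpha> (x - x\<^sub>0)) ((y - y\<^sub>0) - \<beta> (x - x\<^sub>0)) - (x - x\<^sub>0)\<^sup>3\<close>,
  that is, \<open>\<alpha>\<close> and \<open>\<beta>\<close> are the slopes of the two tangent lines at the singular point
  \<open>(x\<^sub>0, y\<^sub>0)\<close>.
\<close>
definition tangent_slopes :: "'a::alg_closed_field weierstrass \<Rightarrow> 'a \<Rightarrow> 'a \<Rightarrow> 'a \<Rightarrow> 'a \<Rightarrow> bool" where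
  "tangent_slopes W x\<^sub>0 y\<^sub>0 \<alpha> \<beta> \<longleftrightarrow>
     weierstrass_poly W =
       [: - [: y\<^sub>0 :] - smult \<alpha> [: - x\<^sub>0, 1 :], 1 :] * [: - [: y\<^sub>0 :] - smult \<beta> [: - x\<^sub>0, 1 :], 1 :]
       - [: [: - x\<^sub>0, 1 :] ^ 3 :]"

definition has_node :: "'a::alg_closed_field weierstrass \<Rightarrow> bool" where
  "has_node W \<longleftrightarrow>
     (\<exists>x y \<alpha> \<beta>. singular_point W x y \<and> tangent_slopes W x y \<alpha> \<beta> \<and> \<alpha> \<noteq> \<beta>)"

definition has_cusp :: "'a::alg_closed_field weierstrass \<Rightarrow> bool" where
  "has_cusp W \<longleftrightarrow>
     (\<exists>x y \<alpha>. singular_point W x y \<and> tangent_slopes W x y \<alpha> \<alpha>)"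


subsection \<open>Minimal models and reduction types\<close>

text \<open>
  The Weierstrass equations of a given elliptic curve are those obtained from one of them by
  the substitutions \<open>x = u\<^sup>2 x' + r\<close>, \<open>y = u\<^sup>3 y' + u\<^sup>2 s x' + t\<close> with \<open>u \<noteq> 0\<close>, after division
  by \<open>u\<^sup>6\<close>. An elliptic curve is given by any one of its Weierstrass equations.
\<close>
definition weierstrass_equation_of :: "'a::field weierstrass \<Rightarrow> 'a weierstrass \<Rightarrow> bool" where
  "weierstrass_equation_of E W \<longleftrightarrow>
     (\<exists>u r s t. u \<noteq> 0 \<and>
        pcompose (map_poly (\<lambda>c. pcompose c [: r, u ^ 2 :]) (weierstrass_poly E))
            [: [: t, u ^ 2 * s :], [: u ^ 3 :] :] =
          smult [: u ^ 6 :] (weierstrass_poly W))"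

definition integral_model :: "'a::valued_field weierstrass \<Rightarrow> 'a weierstrass \<Rightarrow> bool" where
  "integral_model E W \<longleftrightarrow> weierstrass_equation_of E W \<and> set_weierstrass W \<subseteq> val_ring"

definition minimal_model :: "'a::valued_field weierstrass \<Rightarrow> 'a weierstrass \<Rightarrow> bool" where
  "minimal_model E W \<longleftrightarrow> integral_model E W \<and>
     (\<forall>W'. integral_model E W' \<longrightarrow> val (discriminant W) \<le> val (discriminant W'))"

definition reduced_curve :: "'a::valued_field weierstrass \<Rightarrow> 'a residue weierstrass" where
  "reduced_curve W = map_weierstrass to_residue W"

text \<open>
  The reduction types do not depend on the choice of the minimal model, as the reduced curve
  is unique up to isomorphism.
\<close>
definition good_reduction :: "'a::{alg_closed_field, valued_field} weierstrass \<Rightarrow> bool" where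
  "good_reduction E \<longleftrightarrow> (\<exists>W. minimal_model E W \<and> elliptic_curve (reduced_curve W))"

definition multiplicative_reduction :: "'a::{alg_closed_field, valued_field} weierstrass \<Rightarrow> bool" where
  "multiplicative_reduction E \<longleftrightarrow> (\<exists>W. minimal_model E W \<and> has_node (reduced_curve W))"

definition additive_reduction :: "'a::{alg_closed_field, valued_field} weierstrass \<Rightarrow> bool" where
  "additive_reduction E \<longleftrightarrow> (\<exists>W. minimal_model E W \<and> has_cusp (reduced_curve W))"

end

theory Submission
  imports Defs
begin

text \<open>
  Over a field in which 2 and 3 are invertible, \<open>E\<close> has the equations
  \<open>y\<^sup>2 = x\<^sup>3 - c\<^sub>4 / (48 u\<^sup>4) x - c\<^sub>6 / (864 u\<^sup>6)\<close> for all \<open>u \<noteq> 0\<close>. If \<open>v(j) \<ge> 0\<close>, choosing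
  \<open>u\<^sup>1\<^sup>2 = \<Delta>\<close> makes this integral with discriminant 1, so minimal models have unit discriminant.
  If \<open>v(j) < 0\<close>, choosing \<open>u\<^sup>4 = c\<^sub>4\<close> makes it integral with \<open>c\<^sub>4 = 1\<close> and \<open>\<Delta> = 1 / j\<close>; as
  \<open>v(\<Delta>) = 3 v(c\<^sub>4) - v(j)\<close> for every model, minimal models have unit \<open>c\<^sub>4\<close> and \<open>v(\<Delta>) > 0\<close>.
  The reduced curve is nonsingular iff its \<open>\<Delta>\<close> is nonzero, and at a singular point with tangent
  slopes \<open>\<alpha>\<close> and \<open>\<beta>\<close> one has \<open>c\<^sub>4 = (\<alpha> - \<beta>)\<^sup>4\<close>, which separates nodes from cusps.
\<close>

section \<open>Singular points and the invariants\<close>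

definition c6 :: "'a::comm_ring_1 weierstrass \<Rightarrow> 'a" where
  "c6 W = - (b2 W ^ 3) + 36 * b2 W * b4 W - 216 * b6 W"

lemma b8_relation: "4 * b8 W = b2 W * b6 W - b4 W ^ 2"
  by (simp add: b2_def b4_def b6_def b8_def algebra_simps power2_eq_square)

text \<open>This identity makes \<open>c6\<close> integral once \<open>c4\<close> and the
  discriminant are, and gives \<open>c4 W ^ 3 = c6 W ^ 2\<close> when the discriminant
  vanishes.\<close>

lemma c4_cubed_minus_c6_squared: "c4 W ^ 3 - c6 W ^ 2 = 1728 * discriminant W"
proof -
  \<comment> \<open>Splitting 1728 as 432 times 4 makes \<open>b8\<close> appear as
    \<open>4 * b8 W\<close>, which \<open>b8_relation\<close> eliminates without division.\<close>
  have "1728 * discriminant W = - 432 * b2 W ^ 2 * (4 * b8 W)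
      + 1728 * (9 * b2 W * b4 W * b6 W - 8 * b4 W ^ 3 - 27 * b6 W ^ 2)"
    by (simp add: discriminant_def algebra_simps)
  also have "\<dots> = c4 W ^ 3 - c6 W ^ 2"
    unfolding b8_relation c4_def c6_def
    by (simp add: algebra_simps power2_eq_square power3_eq_cube)
  finally show ?thesis ..
qed

lemma c4_short: "c4 (Weierstrass 0 0 0 A B) = - 48 * A"
  and c6_short: "c6 (Weierstrass 0 0 0 A B) = - 864 * B"
  by (simp_all add: c4_def c6_def b2_def b4_def b6_def)

section \<open>Singular points and their tangent slopes\<close>

lemma singular_point_iff:
  "singular_point W x y \<longleftrightarrow>
     y\<^sup>2 + a1 W * x * y + a3 W * y = x ^ 3 + a2 W * x\<^sup>2 + a4 W * x + a6 W \<and>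
     a1 W * y = 3 * x\<^sup>2 + 2 * a2 W * x + a4 W \<and>
     2 * y + a1 W * x + a3 W = 0"
proof -
  have "poly2 (weierstrass_poly W) x y =
      y\<^sup>2 + a1 W * x * y + a3 W * y - (x ^ 3 + a2 W * x\<^sup>2 + a4 W * x + a6 W)"
    by (simp add: weierstrass_poly_def poly2_def algebra_simps power2_eq_square power3_eq_cube)
  moreover have "poly2 (map_poly pderiv (weierstrass_poly W)) x y =
      a1 W * y - (3 * x\<^sup>2 + 2 * a2 W * x + a4 W)"
    by (simp add: weierstrass_poly_def poly2_def map_poly_pCons pderiv_pCons pderiv_minus
        algebra_simps power2_eq_square)
  moreover have "poly2 (pderiv (weierstrass_poly W)) x y = 2 * y + a1 W * x + a3 W"
    by (simp add: weierstrass_poly_def poly2_def pderiv_pCons algebra_simps)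
  ultimately show ?thesis
    by (simp add: singular_point_def)
qed

text \<open>Of the five coefficient equations, those for \<open>a3\<close>, \<open>a4\<close> and
  \<open>a6\<close> follow from the others at a singular point. What remains says that the slopes
  are the roots of T^2 + \<open>a1 W\<close> T - (\<open>a2 W\<close> + 3x).\<close>

lemma tangent_slopes_iff:
  assumes "singular_point W x y"
  shows "tangent_slopes W x y \<alpha> \<beta> \<longleftrightarrow> \<alpha> + \<beta> = - a1 W \<and> \<alpha> * \<beta> = - (a2 W + 3 * x)"
proof -
  define G where "G = [: - [: y :] - smult \<alpha> [: - x, 1 :], 1 :] *
    [: - [: y :] - smult \<beta> [: - x, 1 :], 1 :] - [: [: - x, 1 :] ^ 3 :]"
  have G: "G = [: [: (\<alpha> * x - y) * (\<beta> * x - y) + x ^ 3,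
      - \<alpha> * (\<beta> * x - y) - \<beta> * (\<alpha> * x - y) - 3 * x\<^sup>2, \<alpha> * \<beta> + 3 * x, - 1 :],
      [: \<alpha> * x + \<beta> * x - 2 * y, - \<alpha> - \<beta> :], 1 :]"
    by (simp add: G_def algebra_simps power2_eq_square power3_eq_cube)
  have "tangent_slopes W x y \<alpha> \<beta> \<longleftrightarrow>
      - a6 W = (\<alpha> * x - y) * (\<beta> * x - y) + x ^ 3 \<and>
      - a4 W = - \<alpha> * (\<beta> * x - y) - \<beta> * (\<alpha> * x - y) - 3 * x\<^sup>2 \<and>
      - a2 W = \<alpha> * \<beta> + 3 * x \<and> a3 W = \<alpha> * x + \<beta> * x - 2 * y \<and> a1 W = - \<alpha> - \<beta>"
    unfolding tangent_slopes_def G_def[symmetric] G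
    by (simp add: weierstrass_poly_def)
  also have "\<dots> \<longleftrightarrow> \<alpha> + \<beta> = - a1 W \<and> \<alpha> * \<beta> = - (a2 W + 3 * x)"
    using assms unfolding singular_point_iff by (safe; algebra)
  finally show ?thesis .
qed

text \<open>The singularity equations can be solved for \<open>a3\<close>, \<open>a4\<close>,
  \<open>a6\<close>. Then \<open>b4\<close>, \<open>b6\<close>, \<open>b8\<close> become polynomials
  in x and \<open>b2 W\<close>, for which the discriminant vanishes identically.\<close>

lemma discriminant_eq_0_if_singular:
  assumes "singular_point W x y"
  shows "discriminant W = 0"
proof -
  have a3: "a3 W = - 2 * y - a1 W * x"
    and a4: "a4 W = a1 W * y - 3 * x\<^sup>2 - 2 * a2 W * x"
    and a6: "a6 W = y\<^sup>2 + a1 W * x * y + a3 W * y - x ^ 3 - a2 W * x\<^sup>2 - a4 W * x"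
    using assms unfolding singular_point_iff by algebra+
  have b4: "b4 W = - x * b2 W - 6 * x\<^sup>2"
    unfolding b2_def b4_def a4 a3 by algebra
  have b6: "b6 W = x\<^sup>2 * b2 W + 8 * x ^ 3"
    unfolding b2_def b6_def a6 a4 a3 by algebra
  have b8: "b8 W = - (x ^ 3) * b2 W - 9 * x ^ 4"
    unfolding b2_def b8_def a6 a4 a3 by algebra
  show ?thesis
    unfolding discriminant_def b4 b6 b8 by algebra
qed

text \<open>Here \<open>c4 W\<close> is the square of \<open>b2 W\<close> + 12x, and
  \<open>b2 W\<close> + 12x is the discriminant of the quadratic whose roots are the two
  slopes.\<close>

lemma c4_eq_tangent_slopes:
  assumes "singular_point W x y" "tangent_slopes W x y \<alpha> \<beta>"
  shows "c4 W = (\<alpha> - \<beta>) ^ 4"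
proof -
  have "a3 W = - 2 * y - a1 W * x" "a4 W = a1 W * y - 3 * x\<^sup>2 - 2 * a2 W * x"
    using assms(1) unfolding singular_point_iff by algebra+
  hence "c4 W = (a1 W ^ 2 + 4 * (a2 W + 3 * x)) ^ 2"
    unfolding c4_def b2_def b4_def by algebra
  moreover have "a1 W ^ 2 + 4 * (a2 W + 3 * x) = (\<alpha> - \<beta>) ^ 2"
    using assms(2) unfolding tangent_slopes_iff[OF assms(1)] by algebra
  ultimately show ?thesis by simp
qed

text \<open>
  Completing the square and the cube turns the equation into \<open>Y\<^sup>2 = X\<^sup>3 - 27 c\<^sub>4 X - 54 c\<^sub>6\<close> with
  \<open>X = 36 x + 3 b\<^sub>2\<close>. If \<open>c\<^sub>4\<^sup>3 = c\<^sub>6\<^sup>2\<close>, then \<open>X = - 3 w\<close> is a double root of the right-hand side,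
  where \<open>w\<^sup>2 = c\<^sub>4\<close> and \<open>w\<^sup>3 = c\<^sub>6\<close>.
\<close>
lemma singular_point_exists:
  fixes W :: "'a::alg_closed_field weierstrass"
  assumes "(2::'a) \<noteq> 0" "(3::'a) \<noteq> 0" "discriminant W = 0"
  shows "\<exists>x y. singular_point W x y"
proof -
  have eq: "c4 W ^ 3 = c6 W ^ 2"
    using c4_cubed_minus_c6_squared[of W] assms(3) by simp
  \<comment> \<open>If \<open>c4 W = 0\<close>, then \<open>c6 W = 0\<close> too, and division by
    zero yields the correct value \<open>w = 0\<close>.\<close>
  define w where "w = c6 W / c4 W"
  have w: "w ^ 2 = c4 W" "w ^ 3 = c6 W"
    using eq by (cases "c4 W = 0"; simp add: w_def field_simps power2_eq_square power3_eq_cube)+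
  have "(12::'a) = 2 * 2 * 3" "(24::'a) = 2 * 2 * 2 * 3" "(432::'a) = 2 * 2 * 2 * 2 * 3 * 3 * 3"
    by simp_all
  hence nz: "(12::'a) \<noteq> 0" "(24::'a) \<noteq> 0" "(432::'a) \<noteq> 0"
    using assms(1,2) by (metis mult_eq_0_iff)+
  \<comment> \<open>This solves 36x + 3 \<open>b2 W\<close> = -3w, and \<open>y\<close> is chosen to
    make the y-derivative vanish.\<close>
  define x where "x = - (b2 W + w) / 12"
  define y where "y = - (a1 W * x + a3 W) / 2"
  have "12 * x = - (b2 W + w)"
    unfolding x_def using nz(1) by (metis nonzero_mult_div_cancel_left times_divide_eq_right)
  hence x: "12 * x + b2 W = - w"
    by simp
  have "2 * y = - (a1 W * x + a3 W)"
    unfolding y_def using assms(1) by (metis nonzero_mult_div_cancel_left times_divide_eq_right)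
  hence y: "2 * y + a1 W * x + a3 W = 0"
    by simp
  \<comment> \<open>Completing the square gives the cubic 4x^3 + \<open>b2 W\<close> x^2 + 2
    \<open>b4 W\<close> x + \<open>b6 W\<close>, whose half derivative is treated first. The factors
    24 and 432 allow rewriting in terms of 12x + \<open>b2 W\<close> = -w.\<close>
  have "24 * (6 * x\<^sup>2 + b2 W * x + b4 W) = 0"
    using x w(1) unfolding c4_def by algebra
  hence f': "6 * x\<^sup>2 + b2 W * x + b4 W = 0"
    using nz by (metis mult_eq_0_iff)
  have "432 * (4 * x ^ 3 + b2 W * x\<^sup>2 + 2 * b4 W * x + b6 W) = 0"
    using x w unfolding c4_def c6_def by algebra
  hence f: "4 * x ^ 3 + b2 W * x\<^sup>2 + 2 * b4 W * x + b6 W = 0"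
    using nz by (metis mult_eq_0_iff)
  have "2 * (a1 W * y - (3 * x\<^sup>2 + 2 * a2 W * x + a4 W)) = 0"
    using y f' unfolding b2_def b4_def by algebra
  moreover have "2 * (2 * (y\<^sup>2 + a1 W * x * y + a3 W * y -
      (x ^ 3 + a2 W * x\<^sup>2 + a4 W * x + a6 W))) = 0"
    using y f unfolding b2_def b4_def b6_def by algebra
  ultimately have "singular_point W x y"
    unfolding singular_point_iff using y assms(1) by (metis mult_eq_0_iff eq_iff_diff_eq_0)
  thus ?thesis by blast
qed

text \<open>One root of the quadratic for the slopes exists by algebraic closedness; the other is
  then determined by the sum of the roots.\<close>

lemma tangent_slopes_exist:
  fixes W :: "'a::alg_closed_field weierstrass"
  assumes "singular_point W x y"
  shows "\<exists>\<alpha> \<beta>. tangent_slopes W x y \<alpha> \<beta>"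
proof -
  have "degree [: - (a2 W + 3 * x), a1 W, 1 :] > 0"
    by simp
  then obtain \<alpha> where "poly [: - (a2 W + 3 * x), a1 W, 1 :] \<alpha> = 0"
    using alg_closed_imp_poly_has_root by blast
  hence "\<alpha> + (- a1 W - \<alpha>) = - a1 W \<and> \<alpha> * (- a1 W - \<alpha>) = - (a2 W + 3 * x)"
    by (simp add: algebra_simps)
  thus ?thesis
    using tangent_slopes_iff[OF assms] by blast
qed

section \<open>Smooth, nodal and cuspidal curves in terms of \<open>discriminant\<close> and
  \<open>c4\<close>\<close>

lemma elliptic_curve_iff:
  fixes W :: "'a::alg_closed_field weierstrass"
  assumes "(2::'a) \<noteq> 0" "(3::'a) \<noteq> 0"
  shows "elliptic_curve W \<longleftrightarrow> discriminant W \<noteq> 0"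
  using discriminant_eq_0_if_singular singular_point_exists[OF assms]
  unfolding elliptic_curve_def by blast

lemma has_node_iff:
  fixes W :: "'a::alg_closed_field weierstrass"
  assumes "(2::'a) \<noteq> 0" "(3::'a) \<noteq> 0"
  shows "has_node W \<longleftrightarrow> discriminant W = 0 \<and> c4 W \<noteq> 0"
proof
  assume "has_node W"
  thus "discriminant W = 0 \<and> c4 W \<noteq> 0"
    by (auto simp: has_node_def discriminant_eq_0_if_singular c4_eq_tangent_slopes)
next
  assume *: "discriminant W = 0 \<and> c4 W \<noteq> 0"
  then obtain x y \<alpha> \<beta> where "singular_point W x y" "tangent_slopes W x y \<alpha> \<beta>"
    using singular_point_exists[OF assms] tangent_slopes_exist by blast
  moreover from this * have "\<alpha> \<noteq> \<beta>"
    using c4_eq_tangent_slopes by fastforce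
  ultimately show "has_node W"
    unfolding has_node_def by blast
qed

lemma has_cusp_imp:
  assumes "has_cusp W"
  shows "discriminant W = 0" "c4 W = 0"
  using assms by (auto simp: has_cusp_def discriminant_eq_0_if_singular c4_eq_tangent_slopes)


section \<open>Changes of coordinates\<close>

text \<open>Comparing coefficients after the substitution gives the classical transformation
  formulas.\<close>

lemma weierstrass_equation_of_iff:
  "weierstrass_equation_of E W \<longleftrightarrow> (\<exists>u r s t. u \<noteq> 0 \<and>
     u * a1 W = a1 E + 2 * s \<and>
     u ^ 2 * a2 W = a2 E - s * a1 E + 3 * r - s\<^sup>2 \<and>
     u ^ 3 * a3 W = a3 E + r * a1 E + 2 * t \<and>
     u ^ 4 * a4 W = a4 E - s * a3 E + 2 * r * a2 E - (t + r * s) * a1 E + 3 * r\<^sup>2 - 2 * s * t \<and>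
     u ^ 6 * a6 W = a6 E + r * a4 E + r\<^sup>2 * a2 E + r ^ 3 - t * a3 E - t\<^sup>2 - r * t * a1 E)"
proof -
  have "pcompose (map_poly (\<lambda>c. pcompose c [: r, u ^ 2 :]) (weierstrass_poly E))
          [: [: t, u ^ 2 * s :], [: u ^ 3 :] :] = smult [: u ^ 6 :] (weierstrass_poly W) \<longleftrightarrow>
     u * a1 W = a1 E + 2 * s \<and>
     u ^ 2 * a2 W = a2 E - s * a1 E + 3 * r - s\<^sup>2 \<and>
     u ^ 3 * a3 W = a3 E + r * a1 E + 2 * t \<and>
     u ^ 4 * a4 W = a4 E - s * a3 E + 2 * r * a2 E - (t + r * s) * a1 E + 3 * r\<^sup>2 - 2 * s * t \<and>
     u ^ 6 * a6 W = a6 E + r * a4 E + r\<^sup>2 * a2 E + r ^ 3 - t * a3 E - t\<^sup>2 - r * t * a1 E"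
    (is "?L = ?R \<longleftrightarrow> ?C") if "u \<noteq> 0" for u r s t
  proof -
    \<comment> \<open>The monomial x^i y^j carries the factor u^(2i+3j) on the left and u^6 on the
      right; cancelling the common power of \<open>u\<close> leaves the weight of each
      coefficient.\<close>
    have L: "?L = [: - [: a6 E + r * a4 E + r\<^sup>2 * a2 E + r ^ 3 - t * a3 E - t\<^sup>2 - r * t * a1 E,
        u ^ 2 * (a4 E - s * a3 E + 2 * r * a2 E - (t + r * s) * a1 E + 3 * r\<^sup>2 - 2 * s * t),
        u ^ 4 * (a2 E - s * a1 E + 3 * r - s\<^sup>2), u ^ 6 :],
        [: u ^ 3 * (a3 E + r * a1 E + 2 * t), u ^ 5 * (a1 E + 2 * s) :], [: u ^ 6 :] :]"
      by (simp add: weierstrass_poly_def map_poly_pCons pcompose_pCons pcompose_1 algebra_simps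
          power_numeral_reduce)
    have R: "?R = [: - [: u ^ 6 * a6 W, u ^ 2 * (u ^ 4 * a4 W), u ^ 4 * (u\<^sup>2 * a2 W), u ^ 6 :],
        [: u ^ 3 * (u ^ 3 * a3 W), u ^ 5 * (u * a1 W) :], [: u ^ 6 :] :]"
      by (simp add: weierstrass_poly_def algebra_simps power_numeral_reduce)
    show ?thesis
      unfolding eq_commute[of ?L ?R] unfolding L R using that
      by (simp only: pCons_eq_iff neg_equal_iff_equal mult_cancel_left power_eq_0_iff) blast
  qed
  thus ?thesis
    unfolding weierstrass_equation_of_def by meson
qed

lemma weierstrass_equation_of_invariants:
  assumes "weierstrass_equation_of E W"
  obtains u where "u \<noteq> 0" "c4 E = u ^ 4 * c4 W" "discriminant E = u ^ 12 * discriminant W"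
proof -
  from assms obtain u r s t where "u \<noteq> 0" and
    eqs: "u * a1 W = a1 E + 2 * s"
     "u ^ 2 * a2 W = a2 E - s * a1 E + 3 * r - s\<^sup>2"
     "u ^ 3 * a3 W = a3 E + r * a1 E + 2 * t"
     "u ^ 4 * a4 W = a4 E - s * a3 E + 2 * r * a2 E - (t + r * s) * a1 E + 3 * r\<^sup>2 - 2 * s * t"
     "u ^ 6 * a6 W = a6 E + r * a4 E + r\<^sup>2 * a2 E + r ^ 3 - t * a3 E - t\<^sup>2 - r * t * a1 E"
    unfolding weierstrass_equation_of_iff by blast
  have b2: "u ^ 2 * b2 W = b2 E + 12 * r"
    using eqs(1,2) unfolding b2_def by algebra
  have b4: "u ^ 4 * b4 W = b4 E + r * b2 E + 6 * r\<^sup>2"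
    using eqs(1,3,4) unfolding b2_def b4_def by algebra
  have b6: "u ^ 6 * b6 W = b6 E + 2 * r * b4 E + r\<^sup>2 * b2 E + 4 * r ^ 3"
    using eqs(3,5) unfolding b2_def b4_def b6_def by algebra
  \<comment> \<open>Grouping each coefficient with its power of \<open>u\<close> lets the
    transformation formulas be substituted directly.\<close>
  have "u ^ 8 * b8 W = (u * a1 W)\<^sup>2 * (u ^ 6 * a6 W) + 4 * (u\<^sup>2 * a2 W) * (u ^ 6 * a6 W)
      - (u * a1 W) * (u ^ 3 * a3 W) * (u ^ 4 * a4 W) + (u\<^sup>2 * a2 W) * (u ^ 3 * a3 W)\<^sup>2
      - (u ^ 4 * a4 W)\<^sup>2"
    unfolding b8_def by algebra
  also have "\<dots> = b8 E + 3 * r * b6 E + 3 * r\<^sup>2 * b4 E + r ^ 3 * b2 E + 3 * r ^ 4"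
    unfolding eqs b2_def b4_def b6_def b8_def by algebra
  finally have b8: "u ^ 8 * b8 W = b8 E + 3 * r * b6 E + 3 * r\<^sup>2 * b4 E + r ^ 3 * b2 E + 3 * r ^ 4" .
  have "u ^ 4 * c4 W = (u\<^sup>2 * b2 W)\<^sup>2 - 24 * (u ^ 4 * b4 W)"
    unfolding c4_def by algebra
  also have "\<dots> = c4 E"
    unfolding b2 b4 c4_def by algebra
  finally have c4: "c4 E = u ^ 4 * c4 W" ..
  have "u ^ 12 * discriminant W = - ((u\<^sup>2 * b2 W)\<^sup>2 * (u ^ 8 * b8 W)) - 8 * (u ^ 4 * b4 W) ^ 3
      - 27 * (u ^ 6 * b6 W)\<^sup>2 + 9 * (u\<^sup>2 * b2 W) * (u ^ 4 * b4 W) * (u ^ 6 * b6 W)"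
    unfolding discriminant_def by algebra
  \<comment> \<open>The terms involving \<open>r\<close> cancel only modulo the relation between
    \<open>b8\<close> and the other invariants.\<close>
  also have "\<dots> = discriminant E"
    using b8_relation[of E] unfolding b2 b4 b6 b8 discriminant_def by algebra
  finally have "discriminant E = u ^ 12 * discriminant W" ..
  with \<open>u \<noteq> 0\<close> c4 show ?thesis by (rule that)
qed

lemma j_invariant_weierstrass_equation_of:
  assumes "weierstrass_equation_of E W"
  shows "j_invariant W = j_invariant E"
proof -
  obtain u where "u \<noteq> 0" "c4 E = u ^ 4 * c4 W" "discriminant E = u ^ 12 * discriminant W"
    using assms by (rule weierstrass_equation_of_invariants)
  thus ?thesis
    by (simp add: j_invariant_def power_mult_distrib flip: power_mult)
qed

text \<open>Completing the square and the cube, then scaling by \<open>u\<close>, leads to this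
  equation.\<close>

lemma short_weierstrass_equation_of:
  fixes E :: "'a::field weierstrass"
  assumes "(2::'a) \<noteq> 0" "(3::'a) \<noteq> 0" "u \<noteq> 0"
  shows "weierstrass_equation_of E
    (Weierstrass 0 0 0 (- c4 E / (48 * u ^ 4)) (- c6 E / (864 * u ^ 6)))"
proof -
  have "(12::'a) = 2 * 2 * 3" "(24::'a) = 2 * 2 * 2 * 3" "(48::'a) = 2 * 2 * 2 * 2 * 3"
    "(864::'a) = 2 * 2 * 2 * 2 * 2 * 3 * 3 * 3"
    by simp_all
  hence nz: "(12::'a) \<noteq> 0" "(24::'a) \<noteq> 0" "(48::'a) \<noteq> 0" "(864::'a) \<noteq> 0"
    using assms(1,2) by (metis mult_eq_0_iff)+
  \<comment> \<open>The choices of \<open>s\<close>, \<open>r\<close> and \<open>t\<close> make the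
    new \<open>a1\<close>, \<open>a2\<close> and \<open>a3\<close> vanish, respectively.\<close>
  define r where "r = - b2 E / 12"
  define s where "s = - a1 E / 2"
  define t where "t = - (a3 E + r * a1 E) / 2"
  have r: "12 * r = - b2 E" and s: "2 * s = - a1 E" and t: "2 * t = - (a3 E + r * a1 E)"
    using nz assms by (simp_all add: r_def s_def t_def)
  have "12 * (a2 E - s * a1 E + 3 * r - s\<^sup>2) = 0"
    using r s unfolding b2_def by algebra
  hence e2: "a2 E - s * a1 E + 3 * r - s\<^sup>2 = 0"
    using nz by (metis mult_eq_0_iff)
  have "48 * (a4 E - s * a3 E + 2 * r * a2 E - (t + r * s) * a1 E + 3 * r\<^sup>2 - 2 * s * t) = - c4 E"
    using r s t unfolding c4_def b2_def b4_def by algebra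
  hence e4: "- c4 E / 48 =
      a4 E - s * a3 E + 2 * r * a2 E - (t + r * s) * a1 E + 3 * r\<^sup>2 - 2 * s * t"
    using nz by (simp add: field_simps)
  have "864 * (a6 E + r * a4 E + r\<^sup>2 * a2 E + r ^ 3 - t * a3 E - t\<^sup>2 - r * t * a1 E) = - c6 E"
    using r t unfolding c6_def b2_def b4_def b6_def by algebra
  hence e6: "- c6 E / 864 =
      a6 E + r * a4 E + r\<^sup>2 * a2 E + r ^ 3 - t * a3 E - t\<^sup>2 - r * t * a1 E"
    using nz by (simp add: field_simps)
  show ?thesis
    unfolding weierstrass_equation_of_iff
    by (rule exI[of _ u], rule exI[of _ r], rule exI[of _ s], rule exI[of _ t],
        unfold e4[symmetric] e6[symmetric] e2)
      (use assms s t in simp)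
qed


section \<open>Integrality and reduction\<close>

lemma val_ring_power: "x \<in> val_ring \<Longrightarrow> x ^ n \<in> val_ring"
  by (induction n) (simp_all add: val_ring_mult)

lemma val_ring_of_nat: "of_nat n \<in> val_ring"
  by (induction n) (simp_all add: val_ring_add)

lemma val_ring_numeral: "numeral n \<in> val_ring"
  using val_ring_of_nat[of "numeral n"] by simp

lemmas val_ring_intros = val_ring_add val_ring_diff val_ring_minus val_ring_mult val_ring_power
  val_ring_numeral

lemma to_residue_diff:
  "x \<in> val_ring \<Longrightarrow> y \<in> val_ring \<Longrightarrow> to_residue (x - y) = to_residue x - to_residue y"
  by (simp add: minus_residue.abs_eq eq_onp_def)

lemma to_residue_minus: "x \<in> val_ring \<Longrightarrow> to_residue (- x) = - to_residue x"
  by (simp add: uminus_residue.abs_eq eq_onp_def)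

lemma to_residue_power: "x \<in> val_ring \<Longrightarrow> to_residue (x ^ n) = to_residue x ^ n"
  by (induction n) (simp_all add: to_residue_mult val_ring_power)

lemma to_residue_of_nat: "to_residue (of_nat n) = of_nat n"
  by (induction n) (simp_all add: to_residue_add val_ring_of_nat)

lemma to_residue_numeral: "to_residue (numeral n) = numeral n"
  using to_residue_of_nat[of "numeral n"] by simp

lemmas to_residue_simps = to_residue_add to_residue_diff to_residue_minus to_residue_mult
  to_residue_power to_residue_numeral

lemma to_residue_eq_0_iff:
  assumes "x \<in> val_ring"
  shows "to_residue x = 0 \<longleftrightarrow> val x \<noteq> 0"
  using to_residue_eq_iff[OF assms val_ring_0] assms
  by (auto simp: val_ideal_def val_ring_def)

text \<open>Transfers the condition on the residue characteristic to the field: 2 and 3 become units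
  of \<open>val_ring\<close>.\<close>

lemma val_numeral_eq_0:
  assumes "(numeral n :: 'a::valued_field residue) \<noteq> 0"
  shows "val (numeral n :: 'a) = 0"
  using assms to_residue_eq_0_iff[of "numeral n :: 'a"] by (simp add: val_ring_numeral to_residue_numeral)

lemma prime_field_char_neq_0:
  assumes "CHAR('a::field) \<noteq> p" "prime p"
  shows "(of_nat p :: 'a) \<noteq> 0"
proof
  assume "(of_nat p :: 'a) = 0"
  hence "CHAR('a) dvd p"
    by (simp add: of_nat_eq_0_iff_char_dvd)
  hence "CHAR('a) = 1"
    using assms prime_nat_iff by auto
  thus False
    using of_nat_CHAR[where ?'a = 'a] by simp
qed

lemma val_power: "val (x ^ n) = ereal (real n) * val x"
proof (cases "x = 0")
  case True
  \<comment> \<open>For \<open>n = 0\<close> the convention that 0 times infinity is 0 agrees with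
    \<open>val 1 = 0\<close>.\<close>
  thus ?thesis by (cases n) (simp_all add: zero_ereal_def[symmetric])
next
  case False
  then obtain a where a: "val x = ereal a"
    using val_eq_infinity_iff[of x] val_neq_minus_infinity[of x] by (cases "val x") auto
  have "val (x ^ n) = ereal (real n * a)"
    by (induction n) (simp_all add: val_mult a algebra_simps zero_ereal_def)
  thus ?thesis
    by (simp add: a)
qed

lemma val_ring_power_iff:
  assumes "n > 0"
  shows "x ^ n \<in> val_ring \<longleftrightarrow> x \<in> val_ring"
  using assms by (cases "val x") (auto simp: val_ring_def val_power zero_le_mult_iff)

lemma val_ring_divide:
  assumes "x \<in> val_ring" "val y = 0"
  shows "x / y \<in> val_ring"
  using assms by (cases "y = 0") (simp_all add: val_ring_def divide_inverse val_mult val_inverse)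

section \<open>Integral Weierstrass equations and their reductions\<close>

lemma set_weierstrass_eq: "set_weierstrass W = {a1 W, a2 W, a3 W, a4 W, a6 W}"
  by (cases W) simp

lemma invariants_in_val_ring:
  assumes "set_weierstrass W \<subseteq> val_ring"
  shows "c4 W \<in> val_ring" "discriminant W \<in> val_ring"
  using assms
  by (auto simp: set_weierstrass_eq c4_def discriminant_def b2_def b4_def b6_def b8_def
      intro!: val_ring_intros)

lemma invariants_reduced_curve:
  assumes "set_weierstrass W \<subseteq> val_ring"
  shows "c4 (reduced_curve W) = to_residue (c4 W)"
    "discriminant (reduced_curve W) = to_residue (discriminant W)"
proof -
  have *: "a1 W \<in> val_ring" "a2 W \<in> val_ring" "a3 W \<in> val_ring" "a4 W \<in> val_ring"
    "a6 W \<in> val_ring"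
    using assms by (auto simp: set_weierstrass_eq)
  have **: "a1 (reduced_curve W) = to_residue (a1 W)" "a2 (reduced_curve W) = to_residue (a2 W)"
    "a3 (reduced_curve W) = to_residue (a3 W)" "a4 (reduced_curve W) = to_residue (a4 W)"
    "a6 (reduced_curve W) = to_residue (a6 W)"
    by (cases W; simp add: reduced_curve_def)+
  show "c4 (reduced_curve W) = to_residue (c4 W)"
    by (simp add: c4_def b2_def b4_def to_residue_simps val_ring_intros * **)
  show "discriminant (reduced_curve W) = to_residue (discriminant W)"
    by (simp add: discriminant_def b2_def b4_def b6_def b8_def to_residue_simps val_ring_intros * **)
qed

text \<open>The square of the scaled \<open>c6\<close> is a polynomial in the two given integral
  quantities, so the scaled \<open>c6\<close> is integral. As 48 and 864 are units, the short
  equation is integral.\<close>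

lemma integral_short_model:
  fixes E :: "'a::valued_field weierstrass"
  assumes "(2 :: 'a residue) \<noteq> 0" "(3 :: 'a residue) \<noteq> 0" "u \<noteq> 0"
    and c4: "c4 E / u ^ 4 \<in> val_ring" and disc: "discriminant E / u ^ 12 \<in> val_ring"
  obtains W where "integral_model E W" "c4 W = c4 E / u ^ 4"
    "discriminant W = discriminant E / u ^ 12"
proof -
  have v: "val (2::'a) = 0" "val (3::'a) = 0"
    using assms(1,2) val_numeral_eq_0 by blast+
  hence nz: "(2::'a) \<noteq> 0" "(3::'a) \<noteq> 0"
    by (metis PInfty_neq_ereal(1) val_0 zero_ereal_def)+
  have "(48::'a) = 2 ^ 4 * 3" "(864::'a) = 2 ^ 5 * 3 ^ 3"
    by simp_all
  hence v': "val (48::'a) = 0" "val (864::'a) = 0"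
    by (simp_all only: val_mult val_power v) simp_all
  have "(c6 E / u ^ 6) ^ 2 = (c4 E / u ^ 4) ^ 3 - 1728 * (discriminant E / u ^ 12)"
    using c4_cubed_minus_c6_squared[of E] \<open>u \<noteq> 0\<close>
    by (simp add: power_divide field_simps flip: power_mult)
  also have "\<dots> \<in> val_ring"
    using c4 disc by (intro val_ring_intros)
  finally have "c6 E / u ^ 6 \<in> val_ring"
    by (simp add: val_ring_power_iff)
  hence int: "- (c4 E / u ^ 4) / 48 \<in> val_ring" "- (c6 E / u ^ 6) / 864 \<in> val_ring"
    using val_ring_divide[OF val_ring_minus] c4 v' by blast+
  define W where
    "W = Weierstrass 0 0 0 (- c4 E / (48 * u ^ 4)) (- c6 E / (864 * u ^ 6))"
  have "weierstrass_equation_of E W"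
    unfolding W_def using nz \<open>u \<noteq> 0\<close> by (rule short_weierstrass_equation_of)
  moreover have "set_weierstrass W \<subseteq> val_ring"
    using int by (simp add: W_def mult.commute)
  ultimately have "integral_model E W"
    by (simp add: integral_model_def)
  have n48: "(48::'a) \<noteq> 0" "(864::'a) \<noteq> 0"
    using v' by (metis PInfty_neq_ereal(1) val_0 zero_ereal_def)+
  have "c4 W = - 48 * (- c4 E / (48 * u ^ 4))"
    unfolding W_def by (rule c4_short)
  also have "\<dots> = c4 E / u ^ 4"
    using n48 by simp
  finally have c4_W: "c4 W = c4 E / u ^ 4" .
  have "c6 W = - 864 * (- c6 E / (864 * u ^ 6))"
    unfolding W_def by (rule c6_short)
  also have "\<dots> = c6 E / u ^ 6"
    using n48 by simp
  finally have c6_W: "c6 W = c6 E / u ^ 6" .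
  \<comment> \<open>The discriminant is recovered from \<open>c4 W\<close> and \<open>c6 W\<close>
    by cancelling 1728.\<close>
  have "1728 * discriminant W = 1728 * (discriminant E / u ^ 12)"
    using c4_cubed_minus_c6_squared[of W]
    by (simp add: c4_W c6_W power_divide c4_cubed_minus_c6_squared
        flip: power_mult diff_divide_distrib)
  moreover have "(1728::'a) \<noteq> 0"
  proof -
    have "(1728::'a) = 2 * 864" by simp
    thus ?thesis using n48 nz by (metis mult_eq_0_iff)
  qed
  ultimately have "discriminant W = discriminant E / u ^ 12"
    by (metis mult_left_cancel)
  with \<open>integral_model E W\<close> c4_W show ?thesis by (rule that)
qed

section \<open>Minimal models according to the sign of \<open>val (j_invariant E)\<close>\<close>

lemma minimal_model_good:
  fixes E :: "'a::{alg_closed_field, valued_field} weierstrass"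
  assumes "(2 :: 'a residue) \<noteq> 0" "(3 :: 'a residue) \<noteq> 0"
    and "discriminant E \<noteq> 0" "0 \<le> val (j_invariant E)"
  shows "\<exists>W. minimal_model E W"
    and "minimal_model E W \<Longrightarrow> val (discriminant W) = 0"
proof -
  obtain u where u: "u ^ 12 = discriminant E"
    using nth_root_exists[of 12 "discriminant E"] by auto
  hence "u \<noteq> 0"
    using assms(3) by auto
  have "(c4 E / u ^ 4) ^ 3 = j_invariant E"
    by (simp add: j_invariant_def power_divide u flip: power_mult)
  hence "(c4 E / u ^ 4) ^ 3 \<in> val_ring"
    using assms(4) by (simp add: val_ring_def)
  hence "c4 E / u ^ 4 \<in> val_ring"
    by (simp add: val_ring_power_iff)
  moreover have "discriminant E / u ^ 12 \<in> val_ring"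
    using assms(3) by (simp add: u)
  ultimately obtain V where V: "integral_model E V"
    "discriminant V = discriminant E / u ^ 12"
    using integral_short_model[OF assms(1,2) \<open>u \<noteq> 0\<close>] by metis
  have 0: "val (discriminant V) = 0"
    using V(2) assms(3) by (simp add: u)
  \<comment> \<open>Every integral model has discriminant of valuation at least 0, and
    \<open>V\<close> attains this bound.\<close>
  have ge: "0 \<le> val (discriminant W)" if "integral_model E W" for W
    using that invariants_in_val_ring(2)[of W] by (simp add: integral_model_def val_ring_def)
  show "\<exists>W. minimal_model E W"
    using V(1) 0 ge by (auto simp: minimal_model_def)
  show "val (discriminant W) = 0" if "minimal_model E W"
    using that V(1) 0 ge[of W] by (metis antisym minimal_model_def)
qed

lemma minimal_model_multiplicative:
  fixes E :: "'a::{alg_closed_field, valued_field} weierstrass"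
  assumes "(2 :: 'a residue) \<noteq> 0" "(3 :: 'a residue) \<noteq> 0"
    and "discriminant E \<noteq> 0" "val (j_invariant E) < 0"
  shows "\<exists>W. minimal_model E W"
    and "minimal_model E W \<Longrightarrow> val (c4 W) = 0"
    and "minimal_model E W \<Longrightarrow> 0 < val (discriminant W)"
proof -
  have j0: "j_invariant E \<noteq> 0"
    using assms(4) by auto
  hence "c4 E \<noteq> 0"
    by (auto simp: j_invariant_def)
  obtain u where u: "u ^ 4 = c4 E"
    using nth_root_exists[of 4 "c4 E"] by auto
  hence "u \<noteq> 0"
    using \<open>c4 E \<noteq> 0\<close> by auto
  obtain j where j: "val (j_invariant E) = ereal j" "j < 0"
    using assms(4) val_neq_minus_infinity by (cases "val (j_invariant E)") auto
  have u12: "u ^ 12 = c4 E ^ 3"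
    by (simp flip: u power_mult)
  have "discriminant E / u ^ 12 = inverse (j_invariant E)"
    by (simp add: j_invariant_def u12)
  hence "discriminant E / u ^ 12 \<in> val_ring"
    using j0 j by (simp add: val_ring_def val_inverse)
  moreover have "c4 E / u ^ 4 \<in> val_ring"
    using \<open>c4 E \<noteq> 0\<close> by (simp add: u)
  ultimately obtain V where V: "integral_model E V" "c4 V = c4 E / u ^ 4"
    using integral_short_model[OF assms(1,2) \<open>u \<noteq> 0\<close>] by metis
  have V0: "val (c4 V) = 0"
    using V(2) \<open>c4 E \<noteq> 0\<close> by (simp add: u)
  \<comment> \<open>The invariance of j forces \<open>val (discriminant W)\<close> to increase with
    \<open>val (c4 W)\<close>. The lower bound \<open>- j\<close>, reached exactly at
    \<open>c = 0\<close>, is attained by \<open>V\<close>.\<close>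
  have model: "\<exists>c. val (c4 W) = ereal c \<and> 0 \<le> c \<and> val (discriminant W) = ereal (3 * c - j)"
    if W: "integral_model E W" for W
  proof -
    have eq: "weierstrass_equation_of E W" and int: "set_weierstrass W \<subseteq> val_ring"
      using W by (auto simp: integral_model_def)
    have jW: "j_invariant W = j_invariant E"
      using eq by (rule j_invariant_weierstrass_equation_of)
    hence nz: "c4 W \<noteq> 0" "discriminant W \<noteq> 0"
      using j0 by (auto simp: j_invariant_def)
    obtain c d where cd: "val (c4 W) = ereal c" "val (discriminant W) = ereal d"
      using nz val_eq_infinity_iff val_neq_minus_infinity
      by (metis ereal_cases)
    have "val (c4 W ^ 3) = val (j_invariant W) + val (discriminant W)"
      using nz by (simp add: j_invariant_def flip: val_mult)
    moreover have "val (c4 W ^ 3) = ereal (3 * c)"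
      by (simp only: val_power cd times_ereal.simps of_nat_numeral)
    ultimately have "3 * c = j + d"
      by (simp add: jW j cd)
    moreover have "0 \<le> c"
      using invariants_in_val_ring(1)[OF int] cd by (simp add: val_ring_def)
    ultimately show ?thesis
      using cd by auto
  qed
  obtain dV where dV: "val (discriminant V) = ereal (- j)"
    using model[OF V(1)] V0 by auto
  show "\<exists>W. minimal_model E W"
    using V(1) dV model by (fastforce simp: minimal_model_def)
  show "val (c4 W) = 0" "0 < val (discriminant W)" if W: "minimal_model E W"
  proof -
    have "val (discriminant W) \<le> ereal (- j)" "integral_model E W"
      using W V(1) dV by (metis minimal_model_def)+
    then obtain c where "val (c4 W) = ereal c" "0 \<le> c"
      "val (discriminant W) = ereal (3 * c - j)" "3 * c - j \<le> - j"
      using model by fastforce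
    thus "val (c4 W) = 0" "0 < val (discriminant W)"
      using j(2) by auto
  qed
qed

theorem proposition3p10:
  fixes E :: "'a::{alg_closed_field, valued_field} weierstrass"
  assumes "CHAR('a residue) \<noteq> 2" and "CHAR('a residue) \<noteq> 3"
    and "elliptic_curve E"
  shows "(good_reduction E \<longleftrightarrow> 0 \<le> val (j_invariant E)) \<and>
    (multiplicative_reduction E \<longleftrightarrow> val (j_invariant E) < 0) \<and>
    \<not> additive_reduction E"
proof -
  have k: "(2 :: 'a residue) \<noteq> 0" "(3 :: 'a residue) \<noteq> 0"
    using prime_field_char_neq_0[OF assms(1)] prime_field_char_neq_0[OF assms(2)] by simp_all
  have "val (2::'a) = 0" "val (3::'a) = 0"
    using k val_numeral_eq_0 by blast+
  hence K: "(2::'a) \<noteq> 0" "(3::'a) \<noteq> 0"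
    by (metis PInfty_neq_ereal(1) val_0 zero_ereal_def)+
  have disc: "discriminant E \<noteq> 0"
    using assms(3) elliptic_curve_iff[OF K] by blast
  \<comment> \<open>The criteria are applied over the residue field, which is algebraically closed,
    and turn reduction types into conditions on valuations.\<close>
  have red: "elliptic_curve (reduced_curve W) \<longleftrightarrow> val (discriminant W) = 0"
    "has_node (reduced_curve W) \<longleftrightarrow> val (discriminant W) \<noteq> 0 \<and> val (c4 W) = 0"
    "has_cusp (reduced_curve W) \<Longrightarrow> val (discriminant W) \<noteq> 0 \<and> val (c4 W) \<noteq> 0"
    if "minimal_model E W" for W
  proof -
    have W: "set_weierstrass W \<subseteq> val_ring"
      using that by (simp add: minimal_model_def integral_model_def)
    have "discriminant (reduced_curve W) = 0 \<longleftrightarrow> val (discriminant W) \<noteq> 0"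
      "c4 (reduced_curve W) = 0 \<longleftrightarrow> val (c4 W) \<noteq> 0"
      using invariants_reduced_curve[OF W] invariants_in_val_ring[OF W]
      by (simp_all add: to_residue_eq_0_iff)
    thus "elliptic_curve (reduced_curve W) \<longleftrightarrow> val (discriminant W) = 0"
      "has_node (reduced_curve W) \<longleftrightarrow> val (discriminant W) \<noteq> 0 \<and> val (c4 W) = 0"
      "has_cusp (reduced_curve W) \<Longrightarrow> val (discriminant W) \<noteq> 0 \<and> val (c4 W) \<noteq> 0"
      using elliptic_curve_iff[OF k] has_node_iff[OF k] has_cusp_imp by blast+
  qed
  show ?thesis
  proof (cases "0 \<le> val (j_invariant E)")
    case True
    \<comment> \<open>Existence of a minimal model establishes the expected type; the valuations,
      known for all minimal models, exclude the other types.\<close>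
    note min = minimal_model_good[OF k disc True]
    show ?thesis
      using True min red
      unfolding good_reduction_def multiplicative_reduction_def additive_reduction_def
      by (metis not_le)
  next
    case False
    hence neg: "val (j_invariant E) < 0" by simp
    note min = minimal_model_multiplicative[OF k disc neg]
    show ?thesis
      using False neg min red
      unfolding good_reduction_def multiplicative_reduction_def additive_reduction_def
      by (metis less_irrefl)
  qed
qed

end
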